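(* Let $v$ be an archimedean place, $r_v>0$ a real number, and consider $(\mathbb{P}^1(\mathbb{C}_v),\mathcal{O}(1))$ with the line bundle metric (the capacity metric of a disc of radius $r_v$) $$|s([x_0:x_1])|_{L,v}=\frac{|s(x_0,x_1)|_v}{\max(|x_0|_v,\,r_v^{-1}|x_1|_v)}.$$ Let $x=[1:r_v]$ (a point on the boundary of the disc), with local parameter $t=\frac{X_1-r_vX_0}{X_0}$ and local trivialization $\sigma=X_0$ of $L=\mathcal{O}(1)$ around $x$. Then the local Chebyshev transform is given by $$c_{L,v}^{x,\sigma,t}(\alpha)=-\alpha\log(4r_v)+\tfrac12(1+\alpha)\log(1+\alpha)-\tfrac12(1-\alpha)\log(1-\alpha)-\alpha\log(\alpha)$$ for $\alpha\in[0,1]$.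
   Context: Here $\mathbb{C}_v=\mathbb{C}$ with the usual absolute value, and $H^0(\mathbb{P}^1,\mathcal{O}(n))_v=\mathbb{C}[X_0,X_1]_n$ is the space of homogeneous polynomials of degree $n$. For such a section $s$ put $\|s\|_{L^{\otimes n},v}=\sup_{[x_0:x_1]}\frac{|s(x_0,x_1)|}{\max(|x_0|,r_v^{-1}|x_1|)^n}$. If $s\ne0$, write $s=\big(\sum_{m\ge0}a_mt^m\big)\sigma^{\otimes n}$ near $x$, let $\mathrm{ord}_{x,t}(s)=\min\{m:a_m\ne0\}$ and let $\mathrm{lead}_{x,\sigma^{\otimes n},t}(s)=a_{\mathrm{ord}_{x,t}(s)}$. For an integer $0\le m\le n$ put $$F_{L^{\otimes n},v}^{x,\sigma^{\otimes n},t}(m)=\sup_{\mathrm{ord}_{x,t}(s)=m}\frac{|\mathrm{lead}_{x,\sigma^{\otimes n},t}(s)|_v}{\|s\|_{L^{\otimes n},v}}.$$ The Okounkov body is $[0,1]$, and the local Chebyshev transform is $c_{L,v}^{x,\sigma,t}(\alpha)=\lim_{n\to\infty}\frac1n\log F_{L^{\otimes n},v}^{x,\sigma^{\otimes n},t}(m_n)$ for any integers $0\le m_n\le n$ with $m_n/n\to\alpha$; this limit is well defined for $\alpha\in(0,1)$ (Yuan), and the values at $\alpha=0,1$ are understood by continuous extension. Convention: $0\log0=0$. *)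

theory Defs
  imports "HOL-Analysis.Analysis"
begin

text \<open>
  Points \<open>[x0:x1]\<close> of the complex projective line are represented by nonzero pairs
  \<open>(x0, x1)\<close>. A section of \<open>O(n)\<close> is a homogeneous polynomial of degree \<open>n\<close> in two
  variables, represented by the function it defines on pairs; over an infinite
  field the function determines the polynomial.
\<close>

definition sections :: "nat \<Rightarrow> (complex \<times> complex \<Rightarrow> complex) set" where
  "sections n = {s. \<exists>a. \<forall>x0 x1. s (x0, x1) = (\<Sum>k\<le>n. a k * x0 ^ (n - k) * x1 ^ k)}"

text \<open>
  A metric on \<open>O(1)\<close> is given by a gauge \<open>h\<close>, absolutely homogeneous of degree 1 and positive
  on nonzero pairs: the length of a section \<open>s\<close> of \<open>O(n)\<close> at \<open>[p]\<close>, in the induced metric on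
  the tensor power, is \<open>cmod (s p) / h p ^ n\<close>. This quotient does not depend on the
  representative \<open>p\<close>.
\<close>

definition section_length :: "(complex \<times> complex \<Rightarrow> real) \<Rightarrow> nat \<Rightarrow>
    (complex \<times> complex \<Rightarrow> complex) \<Rightarrow> complex \<times> complex \<Rightarrow> real" where
  "section_length h n s p = cmod (s p) / h p ^ n"

definition section_norm :: "(complex \<times> complex \<Rightarrow> real) \<Rightarrow> nat \<Rightarrow>
    (complex \<times> complex \<Rightarrow> complex) \<Rightarrow> real" where
  "section_norm h n s = (SUP p\<in>-{(0, 0)}. section_length h n s p)"

definition disc_gauge :: "real \<Rightarrow> complex \<times> complex \<Rightarrow> real" where
  "disc_gauge r = (\<lambda>(x0, x1). max (cmod x0) (inverse r * cmod x1))"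

text \<open>
  The power series \<open>A\<close> with \<open>s = A(t) \<sigma>^n\<close> near \<open>x\<close>. Here \<open>\<sigma>\<close> is a section of
  \<open>O(1)\<close> that does not vanish at \<open>x\<close>, and \<open>t\<close> is a local parameter at \<open>x\<close>, i.e. a function
  homogeneous of degree 0. Both sides have the same degree of homogeneity, so a neighbourhood of
  a representative of \<open>x\<close> serves as a neighbourhood of the point \<open>x\<close>.
\<close>

definition local_expansion :: "complex \<times> complex \<Rightarrow> (complex \<times> complex \<Rightarrow> complex) \<Rightarrow>
    (complex \<times> complex \<Rightarrow> complex) \<Rightarrow> nat \<Rightarrow> (complex \<times> complex \<Rightarrow> complex) \<Rightarrow> complex fps" where
  "local_expansion x \<sigma> t n s =
     (THE A. fps_conv_radius A > 0 \<and>
             (\<forall>\<^sub>F p in nhds x. s p = eval_fps A (t p) * \<sigma> p ^ n))"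

definition section_ord :: "complex \<times> complex \<Rightarrow> (complex \<times> complex \<Rightarrow> complex) \<Rightarrow>
    (complex \<times> complex \<Rightarrow> complex) \<Rightarrow> nat \<Rightarrow> (complex \<times> complex \<Rightarrow> complex) \<Rightarrow> nat" where
  "section_ord x \<sigma> t n s = subdegree (local_expansion x \<sigma> t n s)"

definition section_lead :: "complex \<times> complex \<Rightarrow> (complex \<times> complex \<Rightarrow> complex) \<Rightarrow>
    (complex \<times> complex \<Rightarrow> complex) \<Rightarrow> nat \<Rightarrow> (complex \<times> complex \<Rightarrow> complex) \<Rightarrow> complex" where
  "section_lead x \<sigma> t n s = fps_nth (local_expansion x \<sigma> t n s) (section_ord x \<sigma> t n s)"

definition chebyshev_F :: "(complex \<times> complex \<Rightarrow> real) \<Rightarrow> complex \<times> complex \<Rightarrow>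
    (complex \<times> complex \<Rightarrow> complex) \<Rightarrow> (complex \<times> complex \<Rightarrow> complex) \<Rightarrow> nat \<Rightarrow> nat \<Rightarrow> real" where
  "chebyshev_F h x \<sigma> t n m =
     (SUP s\<in>{s \<in> sections n. s \<noteq> (\<lambda>_. 0) \<and> section_ord x \<sigma> t n s = m}.
        cmod (section_lead x \<sigma> t n s) / section_norm h n s)"

text \<open>
  The local Chebyshev transform as a relation: \<open>c\<close> satisfies it iff the defining limits on the
  open interval exist, do not depend on the sequence and equal \<open>c\<close>, and the values at 0 and 1
  are given by continuous extension. Values of \<open>c\<close> outside \<open>[0,1]\<close> are irrelevant; those on
  \<open>[0,1]\<close> are uniquely determined.
\<close>

definition has_local_chebyshev_transform :: "(complex \<times> complex \<Rightarrow> real) \<Rightarrow> complex \<times> complex \<Rightarrow>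
    (complex \<times> complex \<Rightarrow> complex) \<Rightarrow> (complex \<times> complex \<Rightarrow> complex) \<Rightarrow> (real \<Rightarrow> real) \<Rightarrow> bool" where
  "has_local_chebyshev_transform h x \<sigma> t c \<longleftrightarrow>
     (\<forall>\<alpha>\<in>{0<..<1}. \<forall>m :: nat \<Rightarrow> nat.
        (\<forall>n. m n \<le> n) \<longrightarrow> (\<lambda>n. real (m n) / real n) \<longlonglongrightarrow> \<alpha> \<longrightarrow>
        (\<lambda>n. 1 / real n * ln (chebyshev_F h x \<sigma> t n (m n))) \<longlonglongrightarrow> c \<alpha>) \<and>
     continuous_on {0..1} c"

lemma has_local_chebyshev_transform_unique:
  assumes c: "has_local_chebyshev_transform h x \<sigma> t c"
    and d: "has_local_chebyshev_transform h x \<sigma> t d"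
    and a: "\<alpha> \<in> {0..1}"
  shows "c \<alpha> = d \<alpha>"
proof -
  have int: "c \<beta> - d \<beta> = 0" if b: "\<beta> \<in> {0<..<1}" for \<beta>
  proof -
    define m where "m = (\<lambda>n. nat \<lfloor>\<beta> * real n\<rfloor>)"
    have le: "m n \<le> n" for n
    proof -
      have "\<beta> * real n \<le> 1 * real n"
        using b by (intro mult_right_mono) auto
      then have "\<lfloor>\<beta> * real n\<rfloor> \<le> int n"
        by (simp add: floor_le_iff)
      then show ?thesis by (simp add: m_def)
    qed
    have m_eq: "real (m n) = of_int \<lfloor>\<beta> * real n\<rfloor>" for n
      using b by (simp add: m_def)
    have lim: "(\<lambda>n. real (m n) / real n) \<longlonglongrightarrow> \<beta>"
    proof (rule tendsto_sandwich)
      show "\<forall>\<^sub>F n in sequentially. \<beta> - 1 / real n \<le> real (m n) / real n"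
        using eventually_gt_at_top[of 0]
      proof eventually_elim
        case (elim n)
        have "\<beta> * real n - 1 \<le> real (m n)" unfolding m_eq by linarith
        then have "(\<beta> * real n - 1) / real n \<le> real (m n) / real n"
          by (rule divide_right_mono) simp
        then show ?case using elim by (simp add: diff_divide_distrib)
      qed
      show "\<forall>\<^sub>F n in sequentially. real (m n) / real n \<le> \<beta>"
        using eventually_gt_at_top[of 0]
      proof eventually_elim
        case (elim n)
        have "real (m n) \<le> \<beta> * real n" unfolding m_eq by linarith
        then show ?case using elim by (simp add: field_simps)
      qed
      show "(\<lambda>n. \<beta> - 1 / real n) \<longlonglongrightarrow> \<beta>"
        using tendsto_diff[OF tendsto_const lim_1_over_n, of \<beta>] by simp
    qed simp
    have "(\<lambda>n. 1 / real n * ln (chebyshev_F h x \<sigma> t n (m n))) \<longlonglongrightarrow> c \<beta>"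
      using c b le lim unfolding has_local_chebyshev_transform_def by blast
    moreover have "(\<lambda>n. 1 / real n * ln (chebyshev_F h x \<sigma> t n (m n))) \<longlonglongrightarrow> d \<beta>"
      using d b le lim unfolding has_local_chebyshev_transform_def by blast
    ultimately show ?thesis
      using LIMSEQ_unique by fastforce
  qed
  have "c \<alpha> - d \<alpha> = 0"
  proof (rule continuous_constant_on_closure[where S = "{0<..<1}" and f = "\<lambda>x. c x - d x"])
    show "continuous_on (closure {0<..<1}) (\<lambda>x. c x - d x)"
      using c d by (auto simp: has_local_chebyshev_transform_def intro!: continuous_intros)
    show "\<alpha> \<in> closure {0<..<1}" using a by simp
  qed (rule int)
  then show ?thesis by simp
qed

end

theory Submission
  imports Defs "HOL-Complex_Analysis.Cauchy_Integral_Formula"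
begin

text \<open>
  In the coordinate \<open>w = X1 / (r X0)\<close> the disc becomes the unit disc and the point becomes \<open>w = 1\<close>. A
  section of \<open>O(n)\<close> vanishing to order \<open>m\<close> at the point is a polynomial \<open>h = (w - 1)^m g\<close> with
  \<open>deg g \<le> n - m\<close>, its norm is the supremum of \<open>|h|\<close> on the unit circle, and its leading coefficient is
  \<open>g(1) / r^m\<close>. So \<open>F\<close> is \<open>r^(-m)\<close> times the largest value of \<open>|g(1)| / sup |h|\<close>.

  Up to a factor polynomial in \<open>n\<close>, which does not affect the limit, the supremum norm may be replaced by
  the \<open>L\<^sup>2\<close> norm on the circle, that is, by the Euclidean norm of the coefficient vector. For that
  norm the extremal polynomial is explicit:
  \<open>E = (w - 1)^m q\<close> with \<open>q = \<Sum>j\<le>n-m. C(m+j, m) C(n-j, m) w^j\<close>, whose coefficients are, up to scaling,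
  the values on \<open>{0..n}\<close> of the discrete Chebyshev (Gram) polynomial of degree \<open>m\<close>.
  Everything rests on one duality identity, lemma \<open>coeff_times_extremal\<close>:
  the coefficient of \<open>w^n\<close> in \<open>h E\<close> is \<open>\<plusminus> C(2m, m) g(1)\<close> for every \<open>g\<close> of degree at most \<open>n - m\<close>.
  Indeed \<open>h E = g (w - 1)^(2m) q\<close>, and the coefficients of \<open>(w - 1)^(2m) q\<close> of index \<open>m, ..., n\<close> are
  \<open>2m\<close>-th finite differences of a polynomial of degree \<open>2m\<close>, hence all equal.

  The identity is used twice. For \<open>h = E\<close> it evaluates the sum of the squared coefficients of the
  palindromic polynomial \<open>E\<close> as \<open>C(2m, m) q(1)\<close>, where \<open>q(1) = C(n+m+1, 2m+1)\<close> by Vandermonde, so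
  that \<open>E\<close> itself gives a lower bound for \<open>F\<close>. For general \<open>h\<close>, Cauchy's estimate for the coefficient
  of \<open>w^n\<close> gives \<open>C(2m, m) |g(1)| \<le> sup |h| sup |E|\<close>, an upper bound. The two bounds
  (lemma \<open>chebyshev_F_bounds\<close>) are
  \<open>r^(-m) (C(n+m+1, 2m+1) / C(2m, m))^(1/2)\<close> divided, respectively multiplied, by \<open>(n + 1)^(1/2)\<close>.
  Stirling's formula to first order then gives the limit.
\<close>

section \<open>Finite differences of polynomials\<close>

lemma backward_difference_degree:
  fixes p :: "'a::comm_ring_1 poly"
  assumes "degree p \<le> Suc N"
  shows "degree (p - pcompose p [:-1, 1:]) \<le> N"
    and "coeff (p - pcompose p [:-1, 1:]) N = of_nat (Suc N) * coeff p (Suc N)"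
proof -
  have "degree (p - pcompose p [:-1, 1:]) \<le> N \<and>
        coeff (p - pcompose p [:-1, 1:]) N = of_nat (Suc N) * coeff p (Suc N)"
    using assms
  proof (induction p arbitrary: N)
    case 0
    then show ?case by simp
  next
    case (pCons a p)
    define D where "D = p - pcompose p [:-1, 1:]"
    have deg: "degree p \<le> N"
      using pCons.prems pCons.hyps by (auto split: if_splits)
    \<comment> \<open>\<open>x p(x) - (x - 1) p(x - 1)\<close> equals \<open>(x - 1) (p(x) - p(x - 1)) + p(x)\<close>.\<close>
    have eq: "pCons a p - pcompose (pCons a p) [:-1, 1:] = pCons 0 D - D + p"
      by (simp add: D_def pcompose_pCons algebra_simps)
    show ?case
    proof (cases N)
      case 0
      then obtain b where "p = [:b:]"
        using deg degree_eq_zeroE by blast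
      then have "D = 0" by (simp add: D_def)
      then show ?thesis unfolding eq using 0 deg by simp
    next
      case (Suc M)
      have IH: "degree D \<le> M" "coeff D M = of_nat (Suc M) * coeff p (Suc M)"
        using pCons.IH[of M] deg Suc by (simp_all add: D_def)
      have "degree (pCons 0 D) \<le> N" "degree D \<le> N"
        using IH(1) Suc degree_pCons_le[of 0 D] by linarith+
      then have "degree (pCons 0 D - D + p) \<le> N"
        using deg by (intro degree_add_le degree_diff_le)
      moreover have "coeff D N = 0"
        using IH(1) Suc by (intro coeff_eq_0) simp
      then have "coeff (pCons 0 D - D + p) N = of_nat (Suc N) * coeff (pCons a p) (Suc N)"
        using IH(2) by (simp add: Suc algebra_simps)
      ultimately show ?thesis unfolding eq by blast
    qed
  qed
  then show "degree (p - pcompose p [:-1, 1:]) \<le> N"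
    and "coeff (p - pcompose p [:-1, 1:]) N = of_nat (Suc N) * coeff p (Suc N)" by blast+
qed

text \<open>
  By Pascal's rule an \<open>(N + 1)\<close>-fold difference is an \<open>N\<close>-fold difference of the first difference, and each
  difference lowers the degree by one while multiplying the leading coefficient by the degree. In
  particular the result does not depend on \<open>x\<close>.
\<close>
lemma finite_difference_poly:
  fixes p :: "'a::{comm_ring_1, semiring_char_0} poly"
  assumes "degree p \<le> N"
  shows "(\<Sum>l\<le>N. (-1) ^ l * of_nat (N choose l) * poly p (x - of_nat l)) = fact N * coeff p N"
  using assms
proof (induction N arbitrary: p)
  case 0
  then obtain a where "p = [:a:]" using degree_eq_zeroE by blast
  then show ?case by simp
next
  case (Suc N)
  define D where "D = p - pcompose p [:-1, 1:]"
  define f where "f l = poly p (x - of_nat l)" for l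
  have D: "poly D (x - of_nat l) = f l - f (Suc l)" for l
    by (simp add: D_def poly_pcompose f_def algebra_simps)
  have "(\<Sum>l\<le>Suc N. (-1) ^ l * of_nat (Suc N choose l) * f l) =
        f 0 + (\<Sum>l\<le>N. (-1) ^ Suc l * of_nat ((N choose l) + (N choose Suc l)) * f (Suc l))"
    by (subst sum.atMost_Suc_shift) (simp add: algebra_simps)
  also have "\<dots> = (f 0 + (\<Sum>l\<le>N. (-1) ^ Suc l * of_nat (N choose Suc l) * f (Suc l))) -
                  (\<Sum>l\<le>N. (-1) ^ l * of_nat (N choose l) * f (Suc l))"
    by (simp add: algebra_simps sum.distrib sum_negf sum_subtractf)
  also have "f 0 + (\<Sum>l\<le>N. (-1) ^ Suc l * of_nat (N choose Suc l) * f (Suc l)) =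
             (\<Sum>l\<le>Suc N. (-1) ^ l * of_nat (N choose l) * f l)"
    by (subst sum.atMost_Suc_shift) simp
  also have "\<dots> = (\<Sum>l\<le>N. (-1) ^ l * of_nat (N choose l) * f l)"
    by (simp add: binomial_eq_0)
  also have "\<dots> - (\<Sum>l\<le>N. (-1) ^ l * of_nat (N choose l) * f (Suc l)) =
             (\<Sum>l\<le>N. (-1) ^ l * of_nat (N choose l) * poly D (x - of_nat l))"
    by (simp add: D sum_subtractf[symmetric] algebra_simps)
  also have "\<dots> = fact N * coeff D N"
    using backward_difference_degree(1)[OF Suc.prems] by (intro Suc.IH) (simp add: D_def)
  also have "\<dots> = fact (Suc N) * coeff p (Suc N)"
    using backward_difference_degree(2)[OF Suc.prems] by (simp add: D_def algebra_simps)
  finally show ?case by (simp add: f_def)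
qed

section \<open>The extremal polynomial\<close>

definition cofactor :: "nat \<Rightarrow> nat \<Rightarrow> complex poly" where
  "cofactor n m = (\<Sum>j\<le>n - m. monom (of_nat ((m + j choose m) * (n - j choose m))) j)"

definition extremal :: "nat \<Rightarrow> nat \<Rightarrow> complex poly" where
  "extremal n m = [:-1, 1:] ^ m * cofactor n m"

lemma coeff_cofactor:
  "coeff (cofactor n m) j = (if j \<le> n - m then of_nat ((m + j choose m) * (n - j choose m)) else 0)"
  unfolding cofactor_def coeff_sum by (simp add: coeff_monom if_distrib cong: if_cong)

text \<open>
  The polynomial that interpolates the coefficients of the cofactor. It also has roots at the \<open>m\<close> integers
  on either side of the index range \<open>{0..n - m}\<close>, and this is why the cofactor behaves under
  multiplication by \<open>(w - 1)^(2m)\<close> as if its coefficients were given by a polynomial everywhere.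
\<close>
lemma binomial_product_poly:
  fixes n m :: nat
  obtains c :: "complex poly" where "degree c \<le> 2 * m" "coeff c (2 * m) = (-1) ^ m / (fact m)\<^sup>2"
    "\<And>y. poly c y = ((of_nat m + y) gchoose m) * ((of_nat n - y) gchoose m)"
proof -
  define A where "A = (\<Prod>i<m. [:of_nat m - of_nat i, 1 :: complex:])"
  define B where "B = (\<Prod>i<m. [:of_nat n - of_nat i, -1 :: complex:])"
  define c where "c = smult (1 / (fact m)\<^sup>2) (A * B)"
  have dA: "degree A = m" unfolding A_def by (subst degree_prod_sum_eq) auto
  have dB: "degree B = m" unfolding B_def by (subst degree_prod_sum_eq) auto
  have lA: "lead_coeff A = 1" unfolding A_def lead_coeff_prod by simp
  have lB: "lead_coeff B = (-1) ^ m" unfolding B_def lead_coeff_prod by simp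
  have "coeff (A * B) (m + m) = (-1) ^ m"
    using coeff_mult_degree_sum[of A B] dA dB lA lB by simp
  moreover have "degree (A * B) \<le> m + m"
    using degree_mult_le[of A B] dA dB by simp
  moreover have "poly c y = ((of_nat m + y) gchoose m) * ((of_nat n - y) gchoose m)" for y
    by (simp add: c_def A_def B_def poly_prod gbinomial_prod_rev lessThan_atLeast0
        power2_eq_square algebra_simps)
  ultimately show ?thesis
    by (intro that[of c]) (auto simp: c_def mult_2 intro: order.trans[OF degree_smult_le])
qed

text \<open>
  The coefficient is a \<open>2m\<close>-th difference of the coefficient sequence of the cofactor, taken over the
  indices from \<open>i - 2m\<close> to \<open>i\<close>. For \<open>m \<le> i \<le> n\<close> these lie between \<open>-m\<close> and \<open>n\<close>, where that sequence,
  extended by zero, agrees with a polynomial of degree \<open>2m\<close>.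
\<close>
lemma coeff_squared_factor_times_cofactor:
  assumes "m \<le> i" "i \<le> n"
  shows "coeff ([:-1, 1:] ^ (2 * m) * cofactor n m) i = (-1) ^ m * of_nat (2 * m choose m)"
proof -
  obtain c :: "complex poly" where c: "degree c \<le> 2 * m" "coeff c (2 * m) = (-1) ^ m / (fact m)\<^sup>2"
    "\<And>y. poly c y = ((of_nat m + y) gchoose m) * ((of_nat n - y) gchoose m)"
    using binomial_product_poly[of m n] by blast
  have cof: "coeff (cofactor n m) j = poly c (of_nat j)" if j: "j \<le> n" for j
  proof -
    have "poly c (of_nat j) = of_nat ((m + j choose m) * (n - j choose m))"
      using j unfolding c(3) by (simp add: binomial_gbinomial of_nat_diff)
    moreover have "(n - j choose m) = 0" if "\<not> j \<le> n - m"
      using that j assms by (intro binomial_eq_0) linarith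
    ultimately show ?thesis by (auto simp: coeff_cofactor)
  qed
  have low: "poly c (of_nat i - of_nat l) = 0" if "i < l" "l \<le> 2 * m" for l
  proof -
    have "of_nat m + (of_nat i - of_nat l) = (of_nat (m + i - l) :: complex)"
      using that assms by (simp add: of_nat_diff)
    moreover have "(m + i - l choose m) = 0"
      using that assms by (intro binomial_eq_0) simp
    ultimately show ?thesis
      unfolding c(3) by (metis binomial_gbinomial mult_zero_left of_nat_0)
  qed
  have "coeff ([:-1, 1:] ^ (2 * m) * cofactor n m) i =
        (\<Sum>l\<le>i. coeff ([:-1, 1:] ^ (2 * m)) l * coeff (cofactor n m) (i - l))"
    by (rule coeff_mult)
  also have "\<dots> = (\<Sum>l\<in>{..i} \<inter> {..2 * m}. (-1) ^ l * of_nat (2 * m choose l) * poly c (of_nat i - of_nat l))"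
  proof (rule sum.mono_neutral_cong_right)
    show "\<forall>l\<in>{..i} - {..i} \<inter> {..2 * m}. coeff ([:-1, 1:] ^ (2 * m)) l * coeff (cofactor n m) (i - l) = 0"
    proof
      fix l assume "l \<in> {..i} - {..i} \<inter> {..2 * m}"
      then have "degree ([:-1, 1 :: complex:] ^ (2 * m)) < l"
        by (auto simp: degree_power_eq)
      then show "coeff ([:-1, 1:] ^ (2 * m)) l * coeff (cofactor n m) (i - l) = 0"
        by (simp add: coeff_eq_0)
    qed
    fix l assume l: "l \<in> {..i} \<inter> {..2 * m}"
    have "(-1 :: complex) ^ (2 * m - l) = (-1) ^ l"
      using l by (intro uminus_power_if[THEN trans] ) (auto simp: uminus_power_if)
    then have "coeff ([:-1, 1 :: complex:] ^ (2 * m)) l = (-1) ^ l * of_nat (2 * m choose l)"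
      using l by (simp add: coeff_linear_poly_power)
    moreover have "coeff (cofactor n m) (i - l) = poly c (of_nat i - of_nat l)"
      using l assms by (subst cof) (auto simp: of_nat_diff)
    ultimately show "coeff ([:-1, 1:] ^ (2 * m)) l * coeff (cofactor n m) (i - l) =
        (-1) ^ l * of_nat (2 * m choose l) * poly c (of_nat i - of_nat l)"
      by simp
  qed auto
  also have "\<dots> = (\<Sum>l\<le>2 * m. (-1) ^ l * of_nat (2 * m choose l) * poly c (of_nat i - of_nat l))"
    by (rule sum.mono_neutral_left) (auto, meson low not_le)
  also have "\<dots> = fact (2 * m) * ((-1) ^ m / (fact m)\<^sup>2)"
    using finite_difference_poly[OF c(1), of "of_nat i"] c(2) by simp
  also have "\<dots> = (-1) ^ m * of_nat (2 * m choose m)"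
    by (simp add: binomial_fact power2_eq_square)
  finally show ?thesis .
qed

text \<open>
  The duality identity: only the coefficients of \<open>(w - 1)^(2m)\<close> times the cofactor with index in
  \<open>{m..n}\<close> meet those of \<open>g\<close>, and they are all equal, so what remains is the sum of the
  coefficients of \<open>g\<close>.
\<close>
lemma coeff_times_extremal:
  assumes "m \<le> n" "degree g \<le> n - m"
  shows "coeff ([:-1, 1:] ^ m * g * extremal n m) n = (-1) ^ m * of_nat (2 * m choose m) * poly g 1"
proof -
  define R where "R = [:-1, 1:] ^ (2 * m) * cofactor n m"
  have "coeff ([:-1, 1:] ^ m * g * extremal n m) n = coeff (g * R) n"
    by (simp only: extremal_def R_def mult_2 power_add) (simp only: mult_ac)
  also have "\<dots> = (\<Sum>j\<le>n. coeff g j * coeff R (n - j))"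
    by (rule coeff_mult)
  also have "\<dots> = (\<Sum>j\<le>n. coeff g j * ((-1) ^ m * of_nat (2 * m choose m)))"
  proof (rule sum.cong)
    fix j assume "j \<in> {..n}"
    show "coeff g j * coeff R (n - j) = coeff g j * ((-1) ^ m * of_nat (2 * m choose m))"
    proof (cases "j \<le> n - m")
      case True
      then show ?thesis
        using assms unfolding R_def by (subst coeff_squared_factor_times_cofactor) auto
    next
      case False
      then show ?thesis using assms by (simp add: coeff_eq_0)
    qed
  qed simp
  also have "\<dots> = (-1) ^ m * of_nat (2 * m choose m) * (\<Sum>j\<le>n. coeff g j)"
    by (simp only: sum_distrib_left) (simp only: mult_ac)
  also have "(\<Sum>j\<le>n. coeff g j) = poly g 1"
    unfolding poly_altdef using assms
    by (intro sum.mono_neutral_cong_right) (auto simp: coeff_eq_0)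
  finally show ?thesis .
qed

text \<open>
  Compare coefficients in \<open>(1 - x)^(-(m+1)) (1 - x)^(-(m+1)) = (1 - x)^(-(2m+2))\<close>: the general Vandermonde
  identity with both upper arguments equal to \<open>-(m + 1)\<close>.
\<close>
lemma sum_choose_choose:
  assumes "m \<le> n"
  shows "(\<Sum>j\<le>n - m. (m + j choose m) * (n - j choose m)) = (n + m + 1 choose (2 * m + 1))"
proof -
  define a :: real where "a = - real (m + 1)"
  have neg: "(a gchoose j) = (-1) ^ j * real (m + j choose m)" for j
  proof -
    have "(a gchoose j) = (-1) ^ j * (real (m + j) gchoose j)"
      unfolding a_def gbinomial_minus by simp
    also have "real (m + j) gchoose j = real (m + j choose m)"
      by (subst binomial_gbinomial[symmetric]) (simp add: binomial_symmetric[of j "m + j"])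
    finally show ?thesis .
  qed
  have "(\<Sum>j\<le>n - m. real (m + j choose m) * real (n - j choose m)) =
        (\<Sum>j\<le>n - m. (-1) ^ (n - m) * ((a gchoose j) * (a gchoose (n - m - j))))"
  proof (rule sum.cong)
    fix j assume "j \<in> {..n - m}"
    then have "(-1 :: real) ^ (n - m) = (-1) ^ j * (-1) ^ (n - m - j)" "m + (n - m - j) = n - j"
      using assms by (simp_all flip: power_add)
    then show "real (m + j choose m) * real (n - j choose m) =
               (-1) ^ (n - m) * ((a gchoose j) * (a gchoose (n - m - j)))"
      unfolding neg by (simp add: mult_ac)
  qed simp
  also have "\<dots> = (-1) ^ (n - m) * ((a + a) gchoose (n - m))"
    unfolding gbinomial_Vandermonde[of a a "n - m", symmetric]
    by (simp only: sum_distrib_left atLeast0AtMost)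
  also have "\<dots> = real (n + m + 1) gchoose (n - m)"
  proof -
    have "a + a = - real (2 * m + 2)" by (simp add: a_def)
    moreover have "real (2 * m + 2) + real (n - m) - 1 = real (n + m + 1)"
      using assms by (simp add: of_nat_diff)
    ultimately show ?thesis
      by (simp only: gbinomial_minus) (simp flip: power_mult_distrib)
  qed
  also have "\<dots> = real (n + m + 1 choose (2 * m + 1))"
    using assms by (subst binomial_gbinomial[symmetric], subst binomial_symmetric) auto
  finally show ?thesis
    by (simp only: flip: of_nat_mult of_nat_sum of_nat_eq_iff[where ?'a = real])
qed

lemma poly_cofactor_1:
  assumes "m \<le> n"
  shows "poly (cofactor n m) 1 = of_nat (n + m + 1 choose (2 * m + 1))"
  unfolding sum_choose_choose[OF assms, symmetric] cofactor_def
  by (simp add: poly_sum poly_monom)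

lemma degree_cofactor:
  assumes "m \<le> n"
  shows "degree (cofactor n m) = n - m"
proof (rule antisym)
  show "degree (cofactor n m) \<le> n - m"
    by (rule degree_le) (simp add: coeff_cofactor)
  have "coeff (cofactor n m) (n - m) \<noteq> 0"
    using assms by (simp add: coeff_cofactor del: of_nat_mult)
  then show "n - m \<le> degree (cofactor n m)" by (rule le_degree)
qed

lemma reflect_cofactor:
  assumes "m \<le> n"
  shows "reflect_poly (cofactor n m) = cofactor n m"
proof (rule poly_eqI)
  fix j
  show "coeff (reflect_poly (cofactor n m)) j = coeff (cofactor n m) j"
  proof (cases "j \<le> n - m")
    case True
    then have "m + (n - m - j) = n - j" "n - (n - m - j) = m + j" "n - m - j \<le> n - m"
      using assms by auto
    then show ?thesis
      using True by (simp add: coeff_reflect_poly degree_cofactor[OF assms] coeff_cofactor mult.commute)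
  qed (simp add: coeff_reflect_poly degree_cofactor[OF assms] coeff_cofactor)
qed

lemma degree_extremal:
  assumes "m \<le> n"
  shows "degree (extremal n m) = n"
proof -
  have "cofactor n m \<noteq> 0"
    using poly_cofactor_1[OF assms] assms by (auto simp del: binomial_Suc_Suc simp: binomial_eq_0_iff)
  then show ?thesis
    using assms by (simp add: extremal_def degree_mult_eq degree_power_eq degree_cofactor)
qed

text \<open>
  Reversing the coefficients fixes the cofactor and changes the sign of \<open>w - 1\<close>. Consequently the
  coefficient of \<open>w^n\<close> in the square of the extremal polynomial is, up to sign, the sum of the squares
  of its coefficients.
\<close>
lemma coeff_extremal_palindromic:
  assumes "m \<le> n" "k \<le> n"
  shows "coeff (extremal n m) (n - k) = (-1) ^ m * coeff (extremal n m) k"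
proof -
  have "reflect_poly [:-1, 1 :: complex:] = smult (-1) [:-1, 1:]"
    by (simp add: reflect_poly_pCons)
  then have "reflect_poly (extremal n m) = smult ((-1) ^ m) (extremal n m)"
    unfolding extremal_def
    by (simp only: reflect_poly_mult reflect_poly_power reflect_cofactor[OF assms(1)]
        smult_power mult_smult_left)
  then have "coeff (reflect_poly (extremal n m)) k = (-1) ^ m * coeff (extremal n m) k"
    by simp
  then show ?thesis
    using assms by (simp add: coeff_reflect_poly degree_extremal)
qed

lemma coeff_extremal_real: "coeff (extremal n m) k \<in> \<real>"
proof -
  have 1: "coeff ([:-1, 1 :: complex:] ^ m) i \<in> \<real>" for i
    by (induction m arbitrary: i) (auto simp: coeff_pCons coeff_1 split: nat.splits)
  show ?thesis
    unfolding extremal_def coeff_mult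
    by (intro sum_in_Reals Reals_mult 1) (simp add: coeff_cofactor)
qed

lemma sum_squares_coeff_extremal:
  assumes "m \<le> n"
  shows "(\<Sum>k\<le>n. (cmod (coeff (extremal n m) k))\<^sup>2) =
         real (2 * m choose m) * real (n + m + 1 choose (2 * m + 1))"
proof -
  let ?b = "coeff (extremal n m)"
  have "of_real (\<Sum>k\<le>n. (cmod (?b k))\<^sup>2) = (\<Sum>k\<le>n. ?b k * ?b k)"
    unfolding of_real_sum
  proof (rule sum.cong)
    fix k
    obtain x where "?b k = of_real x" using coeff_extremal_real Reals_cases by blast
    then show "complex_of_real ((cmod (?b k))\<^sup>2) = ?b k * ?b k"
      by (simp add: power2_eq_square flip: of_real_mult)
  qed simp
  also have "\<dots> = (-1) ^ m * (\<Sum>k\<le>n. ?b k * ?b (n - k))"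
    unfolding sum_distrib_left
    by (intro sum.cong refl, subst coeff_extremal_palindromic[OF assms])
      (auto simp: mult_ac simp flip: power_mult_distrib)
  also have "(\<Sum>k\<le>n. ?b k * ?b (n - k)) = coeff ([:-1, 1:] ^ m * cofactor n m * extremal n m) n"
    by (simp only: coeff_mult extremal_def)
  also have "(-1) ^ m * \<dots> = of_nat (2 * m choose m) * of_nat (n + m + 1 choose (2 * m + 1))"
    by (subst coeff_times_extremal)
      (use assms in \<open>auto simp: degree_cofactor poly_cofactor_1 simp flip: power_mult_distrib\<close>)
  finally have "complex_of_real (\<Sum>k\<le>n. (cmod (?b k))\<^sup>2) =
      of_real (real (2 * m choose m) * real (n + m + 1 choose (2 * m + 1)))"
    by simp
  then show ?thesis by (simp only: of_real_eq_iff)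
qed

text \<open>
  The bound that Cauchy-Schwarz gives for the sum of the absolute values of the coefficients of the extremal
  polynomial, and thus for its supremum on the unit circle.
\<close>
definition extremal_norm_bound :: "nat \<Rightarrow> nat \<Rightarrow> real" where
  "extremal_norm_bound n m = sqrt (real (n + 1) * (real (2 * m choose m) * real (n + m + 1 choose (2 * m + 1))))"

lemma sum_coeff_extremal_le:
  assumes "m \<le> n"
  shows "(\<Sum>k\<le>n. cmod (coeff (extremal n m) k)) \<le> extremal_norm_bound n m"
  unfolding extremal_norm_bound_def
proof (rule real_le_rsqrt)
  show "(\<Sum>k\<le>n. cmod (coeff (extremal n m) k))\<^sup>2 \<le>
      real (n + 1) * (real (2 * m choose m) * real (n + m + 1 choose (2 * m + 1)))"
    using sum_squared_le_sum_of_squares[of "\<lambda>k. cmod (coeff (extremal n m) k)" "{..n}"]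
    unfolding sum_squares_coeff_extremal[OF assms] by (simp add: mult_ac)
qed

section \<open>Leading coefficient against the supremum on the circle\<close>

lemma norm_coeff_le_circle_bound:
  assumes "\<And>w. cmod w = 1 \<Longrightarrow> cmod (poly P w) \<le> M"
  shows "cmod (coeff P k) \<le> M"
proof -
  have "cmod ((deriv ^^ k) (poly P) 0) \<le> fact k * M / 1 ^ k"
    using assms
    by (intro Cauchy_inequality) (auto intro!: holomorphic_intros continuous_intros)
  moreover have "coeff P k = (deriv ^^ k) (poly P) 0 / fact k"
    using fps_nth_conv_deriv[of "fps_of_poly P" k] by (simp add: eval_fps_of_poly[abs_def])
  ultimately show ?thesis
    by (simp add: norm_divide divide_le_eq mult.commute)
qed

lemma pcompose_power:
  fixes p q :: "'a::comm_semiring_1 poly"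
  shows "pcompose (p ^ k) q = pcompose p q ^ k"
  by (induction k) (simp_all add: pcompose_mult pcompose_1)

text \<open>
  Cauchy's estimate for the coefficient of \<open>w^n\<close> in the product of \<open>(w - 1)^m g\<close> with the extremal
  polynomial; by duality this coefficient is a multiple of \<open>g(1)\<close>.
\<close>
lemma poly_at_1_le_circle_bound:
  assumes "m \<le> n" "degree g \<le> n - m"
    and M: "\<And>w. cmod w = 1 \<Longrightarrow> cmod (poly ([:-1, 1:] ^ m * g) w) \<le> M"
  shows "real (2 * m choose m) * cmod (poly g 1) \<le> M * (\<Sum>k\<le>n. cmod (coeff (extremal n m) k))"
proof -
  have "0 \<le> M" by (rule order.trans[OF norm_ge_zero M[of 1]]) simp
  have "cmod (coeff ([:-1, 1:] ^ m * g * extremal n m) n) \<le>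
        M * (\<Sum>k\<le>n. cmod (coeff (extremal n m) k))"
  proof (rule norm_coeff_le_circle_bound)
    fix w :: complex assume w: "cmod w = 1"
    have "cmod (poly (extremal n m) w) \<le> (\<Sum>k\<le>n. cmod (coeff (extremal n m) k))"
      unfolding poly_altdef degree_extremal[OF assms(1)]
      by (rule order.trans[OF norm_sum]) (simp add: norm_mult norm_power w)
    then show "cmod (poly ([:-1, 1:] ^ m * g * extremal n m) w) \<le>
        M * (\<Sum>k\<le>n. cmod (coeff (extremal n m) k))"
      using M[OF w] \<open>0 \<le> M\<close> unfolding poly_mult[of _ "extremal n m"] norm_mult
      by (intro mult_mono) auto
  qed
  then show ?thesis
    unfolding coeff_times_extremal[OF assms(1,2)] by (simp add: norm_mult norm_power)
qed

section \<open>Sections as polynomials\<close>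

definition homogenize :: "nat \<Rightarrow> complex poly \<Rightarrow> complex \<times> complex \<Rightarrow> complex" where
  "homogenize n P = (\<lambda>(x0, x1). \<Sum>k\<le>n. coeff P k * x0 ^ (n - k) * x1 ^ k)"

lemma homogenize_in_sections: "homogenize n P \<in> sections n"
  unfolding sections_def homogenize_def by auto

lemma sectionE:
  assumes "s \<in> sections n"
  obtains P where "degree P \<le> n" "s = homogenize n P"
proof -
  obtain a where a: "\<And>x0 x1. s (x0, x1) = (\<Sum>k\<le>n. a k * x0 ^ (n - k) * x1 ^ k)"
    using assms unfolding sections_def by blast
  define P where "P = (\<Sum>k\<le>n. monom (a k) k)"
  have c: "coeff P k = (if k \<le> n then a k else 0)" for k
    unfolding P_def coeff_sum by (simp add: coeff_monom if_distrib cong: if_cong)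
  have "degree P \<le> n" by (rule degree_le) (simp add: c)
  moreover have "s = homogenize n P"
    by (rule ext) (auto simp: homogenize_def a c)
  ultimately show ?thesis by (rule that)
qed

lemma homogenize_eq_poly:
  assumes "degree P \<le> n" "x0 \<noteq> 0"
  shows "homogenize n P (x0, x1) = poly P (x1 / x0) * x0 ^ n"
proof -
  have "poly P (x1 / x0) = (\<Sum>k\<le>n. coeff P k * (x1 / x0) ^ k)"
    unfolding poly_altdef using assms(1)
    by (intro sum.mono_neutral_cong_left) (auto simp: coeff_eq_0)
  also have "\<dots> * x0 ^ n = (\<Sum>k\<le>n. coeff P k * x0 ^ (n - k) * x1 ^ k)"
    unfolding sum_distrib_right
  proof (rule sum.cong)
    fix k assume "k \<in> {..n}"
    then have "x0 ^ n = x0 ^ (n - k) * x0 ^ k" by (simp flip: power_add)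
    then show "coeff P k * (x1 / x0) ^ k * x0 ^ n = coeff P k * x0 ^ (n - k) * x1 ^ k"
      using assms(2) by (simp add: power_divide)
  qed simp
  finally show ?thesis by (simp add: homogenize_def)
qed

text \<open>
  Away from \<open>X0 = 0\<close> a section is \<open>P(X1 / X0) X0^n\<close>, and \<open>X1 / X0 = c + t\<close>. Uniqueness of the expansion
  follows by restricting to the line \<open>X0 = 1\<close>, on which \<open>t\<close> runs through a neighbourhood of \<open>0\<close>.
\<close>
lemma local_expansion_homogenize:
  assumes "degree P \<le> n"
  shows "local_expansion (1, c) (\<lambda>(x0, x1). x0) (\<lambda>(x0, x1). (x1 - c * x0) / x0) n (homogenize n P) =
         fps_of_poly (pcompose P [:c, 1:])"
  unfolding local_expansion_def
proof (rule the_equality)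
  let ?\<sigma> = "\<lambda>(x0, x1). x0 :: complex" and ?t = "\<lambda>(x0, x1). (x1 - c * x0) / x0"
  have "\<forall>\<^sub>F p in nhds (1 :: complex, c). fst p \<noteq> 0"
    by (rule tendsto_imp_eventually_ne[where c = 1]) (auto intro!: tendsto_eq_intros filterlim_ident)
  then have "\<forall>\<^sub>F p in nhds (1, c). homogenize n P p =
      eval_fps (fps_of_poly (pcompose P [:c, 1:])) (?t p) * ?\<sigma> p ^ n"
  proof eventually_elim
    case (elim p)
    then show ?case
      using assms by (cases p) (simp add: homogenize_eq_poly poly_pcompose diff_divide_distrib)
  qed
  then show "fps_conv_radius (fps_of_poly (pcompose P [:c, 1:])) > 0 \<and>
      (\<forall>\<^sub>F p in nhds (1, c). homogenize n P p =
         eval_fps (fps_of_poly (pcompose P [:c, 1:])) (?t p) * ?\<sigma> p ^ n)"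
    by simp
  \<comment> \<open>On the curve \<open>u \<mapsto> (1, c + u)\<close> the local parameter is \<open>u\<close>, so any other expansion has the same sum.\<close>
  fix B assume B: "fps_conv_radius B > 0 \<and>
      (\<forall>\<^sub>F p in nhds (1, c). homogenize n P p = eval_fps B (?t p) * ?\<sigma> p ^ n)"
  have "filterlim (\<lambda>u. (1, c + u)) (nhds (1 :: complex, c)) (nhds 0)"
    by (auto intro!: tendsto_eq_intros filterlim_ident)
  then have "\<forall>\<^sub>F u in nhds 0. homogenize n P (1, c + u) = eval_fps B (?t (1, c + u)) * ?\<sigma> (1, c + u) ^ n"
    by (rule eventually_compose_filterlim[OF conjunct2[OF B]])
  then have "\<forall>\<^sub>F u in nhds 0. eval_fps B u = eval_fps (fps_of_poly (pcompose P [:c, 1:])) u"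
    by eventually_elim (simp add: homogenize_eq_poly[OF assms] poly_pcompose)
  then show "B = fps_of_poly (pcompose P [:c, 1:])"
    using B by (intro eval_fps_eqD) auto
qed

lemma section_length_homogenize_le:
  assumes "r > 0" "p \<noteq> (0, 0)"
  shows "section_length (disc_gauge r) n (homogenize n P) p \<le> (\<Sum>k\<le>n. cmod (coeff P k) * r ^ k)"
proof -
  obtain x0 x1 where p: "p = (x0, x1)" by (cases p)
  define h where "h = max (cmod x0) (inverse r * cmod x1)"
  have "h > 0" using assms by (auto simp: h_def p less_max_iff_disj)
  have x0: "cmod x0 \<le> h" by (simp add: h_def)
  have x1: "cmod x1 \<le> r * h"
  proof -
    have "r * (inverse r * cmod x1) \<le> r * h"
      using assms by (intro mult_left_mono) (auto simp: h_def)
    then show ?thesis using assms by (simp flip: mult.assoc)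
  qed
  have "cmod (homogenize n P p) \<le> (\<Sum>k\<le>n. cmod (coeff P k) * cmod x0 ^ (n - k) * cmod x1 ^ k)"
    unfolding homogenize_def p
    by (simp, rule order.trans[OF norm_sum]) (simp add: norm_mult norm_power)
  also have "\<dots> \<le> (\<Sum>k\<le>n. cmod (coeff P k) * h ^ (n - k) * (r * h) ^ k)"
    using x0 x1 \<open>h > 0\<close> assms by (intro sum_mono mult_mono power_mono) auto
  also have "\<dots> = (\<Sum>k\<le>n. cmod (coeff P k) * r ^ k) * h ^ n"
    unfolding sum_distrib_right
  proof (rule sum.cong)
    fix k assume "k \<in> {..n}"
    then have "h ^ n = h ^ (n - k) * h ^ k" by (simp flip: power_add)
    then show "cmod (coeff P k) * h ^ (n - k) * (r * h) ^ k = cmod (coeff P k) * r ^ k * h ^ n"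
      by (simp add: power_mult_distrib)
  qed simp
  finally show ?thesis
    using \<open>h > 0\<close> by (simp add: section_length_def disc_gauge_def p h_def[symmetric] divide_le_eq)
qed

lemma section_norm_homogenize_le:
  assumes "r > 0"
  shows "section_norm (disc_gauge r) n (homogenize n P) \<le> (\<Sum>k\<le>n. cmod (coeff P k) * r ^ k)"
  unfolding section_norm_def
proof (rule cSUP_least)
  have "(1, 0) \<in> - {(0 :: complex, 0 :: complex)}" by simp
  then show "- {(0 :: complex, 0 :: complex)} \<noteq> {}" by blast
qed (use assms section_length_homogenize_le in auto)

text \<open>
  The points \<open>[1 : r w]\<close> with \<open>|w| = 1\<close> form the boundary of the disc, where the gauge of the representative
  \<open>(1, r w)\<close> is \<open>1\<close>.
\<close>
lemma poly_le_section_norm: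
  assumes "r > 0" "degree P \<le> n" "cmod w = 1"
  shows "cmod (poly P (of_real r * w)) \<le> section_norm (disc_gauge r) n (homogenize n P)"
  unfolding section_norm_def
proof (rule cSUP_upper2)
  show "bdd_above (section_length (disc_gauge r) n (homogenize n P) ` (- {(0, 0)}))"
    using section_length_homogenize_le[OF assms(1)] by (intro bdd_aboveI2) blast
  show "(1 :: complex, of_real r * w) \<in> - {(0, 0)}" by simp
  show "cmod (poly P (of_real r * w)) \<le>
      section_length (disc_gauge r) n (homogenize n P) (1, of_real r * w)"
    using assms by (simp add: section_length_def disc_gauge_def homogenize_eq_poly norm_mult)
qed

section \<open>Bounds for the finite-level Chebyshev quantity\<close>

context
  fixes r :: real
  assumes r: "r > 0"
begin

abbreviation "sec_ord \<equiv> section_ord (1, of_real r) (\<lambda>(x0, x1). x0) (\<lambda>(x0, x1). (x1 - of_real r * x0) / x0)"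
abbreviation "sec_lead \<equiv> section_lead (1, of_real r) (\<lambda>(x0, x1). x0) (\<lambda>(x0, x1). (x1 - of_real r * x0) / x0)"
abbreviation "sec_norm \<equiv> section_norm (disc_gauge r)"
abbreviation "sec_F \<equiv> chebyshev_F (disc_gauge r) (1, of_real r) (\<lambda>(x0, x1). x0) (\<lambda>(x0, x1). (x1 - of_real r * x0) / x0)"

text \<open>
  Write the section as \<open>t^m S(t)\<close> with \<open>t = r (w - 1)\<close>. In the coordinate \<open>w\<close> it becomes \<open>(w - 1)^m g(w)\<close>
  with \<open>g(1) = r^m S(0)\<close>, and \<open>S(0)\<close> is the leading coefficient.
\<close>
lemma lead_div_norm_le:
  assumes "m \<le> n" "s \<in> sections n" "sec_ord n s = m"
  shows "cmod (sec_lead n s) / sec_norm n s \<le> extremal_norm_bound n m / (real (2 * m choose m) * r ^ m)"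
proof -
  obtain P where P: "degree P \<le> n" "s = homogenize n P"
    using assms(2) by (rule sectionE)
  define Q where "Q = pcompose P [:of_real r, 1:]"
  define S where "S = poly_shift m Q"
  define g where "g = smult (of_real r ^ m) (pcompose S [:- of_real r, of_real r:])"
  have loc: "local_expansion (1, of_real r) (\<lambda>(x0, x1). x0) (\<lambda>(x0, x1). (x1 - of_real r * x0) / x0) n s
      = fps_of_poly Q"
    unfolding P(2) Q_def by (rule local_expansion_homogenize[OF P(1)])
  have sub: "subdegree (fps_of_poly Q) = m"
    using assms(3) by (simp add: section_ord_def loc)
  have lead: "sec_lead n s = coeff Q m"
    using sub by (simp add: section_lead_def section_ord_def loc)
  have "coeff Q k = 0" if "k < m" for k
    using nth_less_subdegree_zero[of k "fps_of_poly Q"] that sub by simp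
  then have QS: "Q = monom 1 m * S"
    by (intro poly_eqI) (auto simp: S_def coeff_monom_mult coeff_poly_shift)
  have "degree Q \<le> n"
    using P(1) by (simp add: Q_def degree_pcompose)
  then have "degree S \<le> n - m"
    by (intro degree_le) (auto simp: S_def coeff_poly_shift intro!: coeff_eq_0)
  then have g: "degree g \<le> n - m"
    using degree_pcompose_le[of S "[:- of_real r, of_real r:]"] r
    by (auto simp: g_def)
  have PQ: "poly P z = poly Q (z - of_real r)" for z
    by (simp add: Q_def poly_pcompose)
  have g1: "poly g 1 = of_real r ^ m * coeff Q m"
    by (simp add: g_def poly_pcompose poly_0_coeff_0 S_def coeff_poly_shift)
  have "real (2 * m choose m) * cmod (poly g 1) \<le>
      sec_norm n s * (\<Sum>k\<le>n. cmod (coeff (extremal n m) k))"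
  proof (rule poly_at_1_le_circle_bound[OF assms(1) g])
    fix w :: complex assume w: "cmod w = 1"
    have "poly ([:-1, 1:] ^ m * g) w = poly P (of_real r * w)"
      unfolding PQ QS
      by (simp add: g_def poly_pcompose poly_monom algebra_simps flip: power_mult_distrib)
    then show "cmod (poly ([:-1, 1:] ^ m * g) w) \<le> sec_norm n s"
      using poly_le_section_norm[OF r P(1) w] by (simp add: P(2))
  qed
  also have N: "sec_norm n s \<ge> 0"
    using order.trans[OF norm_ge_zero poly_le_section_norm[OF r P(1), of 1]] by (simp add: P(2))
  then have "sec_norm n s * (\<Sum>k\<le>n. cmod (coeff (extremal n m) k)) \<le>
      sec_norm n s * extremal_norm_bound n m"
    using sum_coeff_extremal_le[OF assms(1)]
    by (rule mult_left_mono[rotated])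
  finally have *: "real (2 * m choose m) * (r ^ m * cmod (sec_lead n s)) \<le>
      sec_norm n s * extremal_norm_bound n m"
    using r by (simp add: g1 lead norm_mult norm_power)
  have "0 \<le> extremal_norm_bound n m" by (simp add: extremal_norm_bound_def)
  moreover have "real (2 * m choose m) * r ^ m > 0"
    using r by (simp add: binomial_eq_0_iff)
  ultimately show ?thesis
    using * N by (cases "sec_norm n s = 0") (auto simp: field_simps)
qed

text \<open>
  The extremal polynomial, read in the coordinate \<open>w = X1 / (r X0)\<close>, falls short of the upper bound in
  \<open>lead_div_norm_le\<close> by a factor of at most \<open>n + 1\<close>.
\<close>
lemma extremal_section:
  assumes "m \<le> n"
  obtains s where "s \<in> sections n" "s \<noteq> (\<lambda>_. 0)" "sec_ord n s = m"
    "real (n + m + 1 choose (2 * m + 1)) / (r ^ m * extremal_norm_bound n m) \<le>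
     cmod (sec_lead n s) / sec_norm n s"
proof -
  define P where "P = pcompose (extremal n m) [:0, of_real (1 / r):]"
  define s where "s = homogenize n P"
  define Q where "Q = pcompose P [:of_real r, 1:]"
  define T where "T = pcompose (cofactor n m) [:1, of_real (1 / r):]"
  have P: "degree P \<le> n"
    using r degree_extremal[OF assms] by (simp add: P_def degree_pcompose)
  have coeffP: "coeff P k = of_real (1 / r) ^ k * coeff (extremal n m) k" for k
    unfolding P_def by (rule coeff_pcompose_linear)
  have "Q = pcompose (extremal n m) [:1, of_real (1 / r):]"
    unfolding Q_def P_def pcompose_assoc[symmetric] using r by (simp add: pcompose_pCons)
  also have "\<dots> = [:0, of_real (1 / r):] ^ m * T"
    by (simp add: extremal_def pcompose_mult pcompose_power pcompose_pCons T_def)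
  also have "[:0, of_real (1 / r):] ^ m = monom (of_real (1 / r) ^ m :: complex) m"
    by (simp add: monom_altdef flip: smult_power)
  finally have Q: "Q = monom (of_real (1 / r) ^ m) m * T" .
  have "coeff T 0 = of_nat (n + m + 1 choose (2 * m + 1))"
    unfolding poly_0_coeff_0[symmetric] using poly_cofactor_1[OF assms]
    by (simp add: T_def poly_pcompose)
  then have Qm: "coeff Q m = of_real (1 / r) ^ m * of_nat (n + m + 1 choose (2 * m + 1))"
    by (simp add: Q coeff_monom_mult)
  have pos: "0 < (n + m + 1 choose (2 * m + 1))"
    using assms by (intro zero_less_binomial) simp
  then have "coeff Q m \<noteq> 0"
    using r by (simp add: Qm del: binomial_Suc_Suc)
  then have sub: "subdegree (fps_of_poly Q) = m"
    by (intro subdegreeI) (auto simp: Q coeff_monom_mult)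
  have loc: "local_expansion (1, of_real r) (\<lambda>(x0, x1). x0) (\<lambda>(x0, x1). (x1 - of_real r * x0) / x0) n s
      = fps_of_poly Q"
    unfolding s_def Q_def by (rule local_expansion_homogenize[OF P(1)])
  have ord: "sec_ord n s = m"
    by (simp add: section_ord_def loc sub)
  have lead: "cmod (sec_lead n s) = real (n + m + 1 choose (2 * m + 1)) / r ^ m"
    using r by (simp add: section_lead_def ord loc Qm norm_mult norm_divide norm_power power_divide del: binomial_Suc_Suc)
  have "sec_norm n s \<le> (\<Sum>k\<le>n. cmod (coeff P k) * r ^ k)"
    unfolding s_def by (rule section_norm_homogenize_le[OF r])
  also have "\<dots> = (\<Sum>k\<le>n. cmod (coeff (extremal n m) k))"
    using r by (intro sum.cong) (auto simp: coeffP norm_mult norm_divide norm_power power_divide)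
  also have "\<dots> \<le> extremal_norm_bound n m"
    by (rule sum_coeff_extremal_le[OF assms])
  finally have norm_le: "sec_norm n s \<le> extremal_norm_bound n m" .
  have norm_pos: "0 < sec_norm n s"
  proof (rule ccontr)
    \<comment> \<open>Otherwise the extremal polynomial vanishes on the circle, so all its coefficients are zero.\<close>
    assume neg: "\<not> 0 < sec_norm n s"
    have "cmod (coeff (extremal n m) k) \<le> 0" for k
    proof (rule norm_coeff_le_circle_bound)
      fix w :: complex assume "cmod w = 1"
      from poly_le_section_norm[OF r P this] have "cmod (poly (extremal n m) w) \<le> sec_norm n s"
        using r by (simp add: P_def poly_pcompose s_def)
      then show "cmod (poly (extremal n m) w) \<le> 0"
        using neg by linarith
    qed
    then have "extremal n m = 0" by (intro poly_eqI) simp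
    then have "Q = 0" by (simp add: Q_def P_def)
    then show False using \<open>coeff Q m \<noteq> 0\<close> by simp
  qed
  have "(1, 0) \<in> - {(0 :: complex, 0 :: complex)}" by simp
  then have "- {(0 :: complex, 0 :: complex)} \<noteq> {}" by blast
  then have "sec_norm n (\<lambda>_. 0) = 0"
    by (simp add: section_norm_def section_length_def)
  then have "s \<noteq> (\<lambda>_. 0)"
    using norm_pos by auto
  moreover have "real (n + m + 1 choose (2 * m + 1)) / (r ^ m * extremal_norm_bound n m) \<le>
     cmod (sec_lead n s) / sec_norm n s"
    unfolding lead divide_divide_eq_left using norm_le norm_pos r
    by (intro divide_left_mono mult_left_mono mult_pos_pos) auto
  ultimately show ?thesis
    using homogenize_in_sections ord by (intro that[of s]) (auto simp: s_def)
qed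

lemma chebyshev_F_bounds:
  assumes "m \<le> n"
  shows "real (n + m + 1 choose (2 * m + 1)) / (r ^ m * extremal_norm_bound n m) \<le> sec_F n m"
    and "sec_F n m \<le> extremal_norm_bound n m / (real (2 * m choose m) * r ^ m)"
proof -
  let ?X = "{s \<in> sections n. s \<noteq> (\<lambda>_. 0) \<and> sec_ord n s = m}"
  let ?U = "extremal_norm_bound n m / (real (2 * m choose m) * r ^ m)"
  obtain s where s: "s \<in> ?X"
    "real (n + m + 1 choose (2 * m + 1)) / (r ^ m * extremal_norm_bound n m) \<le>
     cmod (sec_lead n s) / sec_norm n s"
    using extremal_section[OF assms] by blast
  have U: "cmod (sec_lead n s) / sec_norm n s \<le> ?U" if "s \<in> ?X" for s
    using that by (intro lead_div_norm_le[OF assms]) auto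
  then have "bdd_above ((\<lambda>s. cmod (sec_lead n s) / sec_norm n s) ` ?X)"
    by (intro bdd_aboveI2)
  then show "real (n + m + 1 choose (2 * m + 1)) / (r ^ m * extremal_norm_bound n m) \<le> sec_F n m"
    unfolding chebyshev_F_def using s by (intro cSUP_upper2)
  show "sec_F n m \<le> ?U"
    unfolding chebyshev_F_def using s(1) U by (intro cSUP_least) blast+
qed

end

section \<open>Asymptotics of factorials and binomial coefficients\<close>

lemma continuous_on_x_ln_x: "continuous_on {0..} (\<lambda>x::real. x * ln x)"
  unfolding continuous_on_def
proof
  fix x :: real assume "x \<in> {0..}"
  show "((\<lambda>x. x * ln x) \<longlongrightarrow> x * ln x) (at x within {0..})"
  proof (cases "x = 0")
    case True
    have "((\<lambda>x::real. x * ln x) \<longlongrightarrow> 0) (at_right 0)"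
      unfolding filterlim_at_right_to_top
    proof (rule Lim_transform_eventually)
      show "((\<lambda>x::real. - (ln x / x)) \<longlongrightarrow> 0) at_top"
        using tendsto_minus[OF ln_x_over_x_tendsto_0] by simp
      show "\<forall>\<^sub>F x in at_top. - (ln x / x) = inverse x * ln (inverse x :: real)"
        using eventually_gt_at_top[of 0] by eventually_elim (simp only: ln_inverse divide_inverse mult_ac mult_minus_right)
    qed
    then show ?thesis by (simp add: True at_within_Ici_at_right)
  qed (auto intro!: tendsto_eq_intros)
qed

lemma tendsto_x_ln_x:
  fixes f :: "nat \<Rightarrow> real"
  assumes "f \<longlonglongrightarrow> a" "\<And>n. 0 \<le> f n"
  shows "(\<lambda>n. f n * ln (f n)) \<longlonglongrightarrow> a * ln a"
proof (rule continuous_on_tendsto_compose[OF continuous_on_x_ln_x assms(1)])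
  show "a \<in> {0..}"
    using LIMSEQ_le_const[OF assms(1), of 0] assms(2) by auto
qed (use assms in auto)

lemma ln_fact_Suc: "ln (fact (Suc k) :: real) = ln (real (Suc k)) + ln (fact k)"
  unfolding fact_Suc of_nat_mult of_nat_fact by (subst ln_mult_pos) simp_all

lemma ln_fact_ge: "real k * ln (real k) - real k \<le> ln (fact k)"
proof (induction k)
  case (Suc k)
  have "real k * (ln (real (Suc k)) - ln (real k)) \<le> 1"
  proof (cases "k = 0")
    case False
    then have "ln (real (Suc k) / real k) \<le> real (Suc k) / real k - 1"
      by (intro ln_le_minus_one) simp
    then have "ln (real (Suc k)) - ln (real k) \<le> 1 / real k"
      using False by (simp add: ln_div field_simps)
    then show ?thesis using False by (simp add: field_simps)
  qed simp
  then show ?case using Suc by (simp add: ln_fact_Suc algebra_simps del: fact_Suc)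
qed simp

lemma ln_fact_le: "ln (fact k) \<le> real (k + 1) * ln (real (k + 1)) - real k"
proof (induction k)
  case (Suc k)
  have "ln (real (k + 1) / real (k + 2)) \<le> real (k + 1) / real (k + 2) - 1"
    by (intro ln_le_minus_one) simp
  also have "\<dots> = - 1 / real (k + 2)" by (simp add: field_simps)
  finally have "1 / real (k + 2) \<le> ln (real (k + 2)) - ln (real (k + 1))"
    by (simp add: ln_div del: of_nat_add)
  then have "1 \<le> real (k + 2) * (ln (real (k + 2)) - ln (real (k + 1)))"
    by (simp add: field_simps)
  then show ?case using Suc by (simp add: ln_fact_Suc algebra_simps del: fact_Suc)
qed simp

text \<open>
  Subtracting \<open>k ln n\<close> turns \<open>k ln k - k\<close> into \<open>n\<close> times \<open>x ln x - x\<close> at \<open>x = k / n\<close>. The upper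
  estimate has \<open>k + 1\<close> in place of \<open>k\<close> in the main term; this moves \<open>x\<close> by \<open>1 / n\<close> and adds \<open>ln n / n\<close>.
  Continuity of \<open>x ln x\<close> at \<open>0\<close> lets \<open>\<beta> = 0\<close> be included.
\<close>
lemma ln_fact_asymptotic:
  fixes k :: "nat \<Rightarrow> nat"
  assumes "(\<lambda>n. real (k n) / real n) \<longlonglongrightarrow> \<beta>"
  shows "(\<lambda>n. (ln (fact (k n)) - real (k n) * ln (real n)) / real n) \<longlonglongrightarrow> \<beta> * ln \<beta> - \<beta>"
proof (rule tendsto_sandwich)
  let ?x = "\<lambda>n. real (k n) / real n" and ?y = "\<lambda>n. real (k n + 1) / real n"
  have y: "?y \<longlonglongrightarrow> \<beta>"
    using tendsto_add[OF assms lim_1_over_n] by (simp add: add_divide_distrib add.commute)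
  show "(\<lambda>n. ?x n * ln (?x n) - ?x n) \<longlonglongrightarrow> \<beta> * ln \<beta> - \<beta>"
    by (intro tendsto_diff tendsto_x_ln_x assms) simp
  have "(\<lambda>n. ?y n * ln (?y n) - ?x n + ln (real n) / real n) \<longlonglongrightarrow> \<beta> * ln \<beta> - \<beta> + 0"
    by (intro tendsto_add tendsto_diff tendsto_x_ln_x y assms lim_ln_over_n) simp
  then show "(\<lambda>n. ?y n * ln (?y n) - ?x n + ln (real n) / real n) \<longlonglongrightarrow> \<beta> * ln \<beta> - \<beta>" by simp
  show "\<forall>\<^sub>F n in sequentially.
      ?x n * ln (?x n) - ?x n \<le> (ln (fact (k n)) - real (k n) * ln (real n)) / real n"
    using eventually_gt_at_top[of 0]
  proof eventually_elim
    case (elim n)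
    have "?x n * ln (?x n) - ?x n = (real (k n) * ln (real (k n)) - real (k n) - real (k n) * ln (real n)) / real n"
      using elim by (cases "k n = 0") (auto simp: ln_div field_simps)
    then show ?case
      using ln_fact_ge[of "k n"] by (simp add: divide_right_mono)
  qed
  show "\<forall>\<^sub>F n in sequentially. (ln (fact (k n)) - real (k n) * ln (real n)) / real n \<le>
      ?y n * ln (?y n) - ?x n + ln (real n) / real n"
    using eventually_gt_at_top[of 0]
  proof eventually_elim
    case (elim n)
    have "?y n * ln (?y n) - ?x n + ln (real n) / real n =
        (real (k n + 1) * ln (real (k n + 1)) - real (k n) - real (k n) * ln (real n)) / real n"
      using elim by (simp add: ln_div field_simps)
    then show ?case
      using ln_fact_le[of "k n"] by (simp add: divide_right_mono del: of_nat_add)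
  qed
qed

text \<open>
  The corrections \<open>k ln n\<close> of the three factorials cancel, as do the linear terms, because \<open>N = k + (N - k)\<close>.
\<close>
lemma ln_binomial_asymptotic:
  fixes k N :: "nat \<Rightarrow> nat"
  assumes le: "\<And>n. k n \<le> N n"
    and k: "(\<lambda>n. real (k n) / real n) \<longlonglongrightarrow> \<kappa>" and N: "(\<lambda>n. real (N n) / real n) \<longlonglongrightarrow> \<nu>"
  shows "(\<lambda>n. ln (real (N n choose k n)) / real n) \<longlonglongrightarrow>
           \<nu> * ln \<nu> - \<kappa> * ln \<kappa> - (\<nu> - \<kappa>) * ln (\<nu> - \<kappa>)"
proof -
  let ?f = "\<lambda>l n. (ln (fact (l n)) - real (l n) * ln (real n)) / real n"
  have d: "(\<lambda>n. real (N n - k n) / real n) \<longlonglongrightarrow> \<nu> - \<kappa>"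
    using tendsto_diff[OF N k] by (simp add: of_nat_diff le diff_divide_distrib)
  have "(\<lambda>n. ?f N n - ?f k n - ?f (\<lambda>n. N n - k n) n) \<longlonglongrightarrow>
      (\<nu> * ln \<nu> - \<nu>) - (\<kappa> * ln \<kappa> - \<kappa>) - ((\<nu> - \<kappa>) * ln (\<nu> - \<kappa>) - (\<nu> - \<kappa>))"
    by (intro tendsto_diff ln_fact_asymptotic N k d)
  also have "(\<lambda>n. ?f N n - ?f k n - ?f (\<lambda>n. N n - k n) n) = (\<lambda>n. ln (real (N n choose k n)) / real n)"
  proof
    fix n
    have "real (N n choose k n) = fact (N n) / (fact (k n) * fact (N n - k n))"
      by (rule binomial_fact[OF le])
    then have "ln (real (N n choose k n)) = ln (fact (N n)) - ln (fact (k n)) - ln (fact (N n - k n))"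
      by (simp add: ln_div ln_mult)
    then show "?f N n - ?f k n - ?f (\<lambda>n. N n - k n) n = ln (real (N n choose k n)) / real n"
      by (simp add: of_nat_diff le algebra_simps flip: diff_divide_distrib)
  qed
  finally show ?thesis by (simp add: algebra_simps)
qed

section \<open>The local Chebyshev transform\<close>

lemma ln_sqrt_mult3:
  fixes a b c :: real
  assumes "0 < a" "0 < b" "0 < c"
  shows "0 < sqrt (a * (b * c))"
   and "ln (sqrt (a * (b * c))) = 1/2 * (ln a + ln b + ln c)"
  using assms by (simp_all add: ln_sqrt ln_mult)

lemma
  assumes "m \<le> n"
  shows extremal_norm_bound_pos: "0 < extremal_norm_bound n m"
    and ln_extremal_norm_bound: "ln (extremal_norm_bound n m) = 1/2 * (ln (real (n + 1)) +
      ln (real (2 * m choose m)) + ln (real (n + m + 1 choose (2 * m + 1))))"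
proof -
  have pos: "0 < real (n + 1)" "0 < real (2 * m choose m)" "0 < real (n + m + 1 choose (2 * m + 1))"
    unfolding of_nat_0_less_iff zero_less_binomial_iff using assms by auto
  show "0 < extremal_norm_bound n m"
    unfolding extremal_norm_bound_def by (rule ln_sqrt_mult3(1)[OF pos])
  show "ln (extremal_norm_bound n m) = 1/2 * (ln (real (n + 1)) +
      ln (real (2 * m choose m)) + ln (real (n + m + 1 choose (2 * m + 1))))"
    unfolding extremal_norm_bound_def by (rule ln_sqrt_mult3(2)[OF pos])
qed

theorem proposition5p3p1:
  fixes r :: real
  assumes "r > 0"
  shows "has_local_chebyshev_transform (disc_gauge r) (1, of_real r)
           (\<lambda>(x0, x1). x0) (\<lambda>(x0, x1). (x1 - of_real r * x0) / x0)
           (\<lambda>\<alpha>. - \<alpha> * ln (4 * r) + 1/2 * (1 + \<alpha>) * ln (1 + \<alpha>)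
                  - 1/2 * (1 - \<alpha>) * ln (1 - \<alpha>) - \<alpha> * ln \<alpha>)"
    (is "has_local_chebyshev_transform ?h ?x ?\<sigma> ?t ?c")
  unfolding has_local_chebyshev_transform_def
proof (intro conjI ballI allI impI)
  have x_ln_x: "continuous_on {0..1} (\<lambda>\<alpha>. f \<alpha> * ln (f \<alpha>))"
    if "continuous_on {0..1} f" "f ` {0..1} \<subseteq> {0..}" for f :: "real \<Rightarrow> real"
    using continuous_on_compose2[OF continuous_on_x_ln_x that] .
  have "continuous_on {0..1} (\<lambda>\<alpha>. - \<alpha> * ln (4 * r) + 1/2 * ((1 + \<alpha>) * ln (1 + \<alpha>))
      - 1/2 * ((1 - \<alpha>) * ln (1 - \<alpha>)) - \<alpha> * ln \<alpha>)"
    by (intro continuous_on_add continuous_on_diff continuous_on_mult continuous_on_const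
        continuous_on_minus continuous_on_id
        x_ln_x[of "\<lambda>\<alpha>. 1 + \<alpha>"] x_ln_x[of "\<lambda>\<alpha>. 1 - \<alpha>"] x_ln_x[of "\<lambda>\<alpha>. \<alpha>"]) auto
  then show "continuous_on {0..1} ?c"
    by (simp only: mult.assoc)
next
  fix \<alpha> :: real and m :: "nat \<Rightarrow> nat"
  assume \<alpha>: "\<alpha> \<in> {0<..<1}" and le: "\<forall>n. m n \<le> n" and lim: "(\<lambda>n. real (m n) / real n) \<longlonglongrightarrow> \<alpha>"
  let ?F = "\<lambda>n. chebyshev_F ?h ?x ?\<sigma> ?t n (m n)"
  let ?A = "\<lambda>n. real (2 * m n choose m n)" and ?B = "\<lambda>n. real (n + m n + 1 choose (2 * m n + 1))"
  \<comment> \<open>The logarithm of the common main term of the lower and the upper bound for \<open>F\<close>.\<close>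
  define G where "G n = 1/2 * (ln (?B n) - ln (?A n)) - real (m n) * ln r" for n
  have A: "0 < ?A n" and B: "0 < ?B n" for n
    using le by (auto simp: zero_less_binomial simp del: binomial_Suc_Suc)
  have E: "0 < extremal_norm_bound n (m n)" for n
    using le by (intro extremal_norm_bound_pos) blast
  have lower: "G n - 1/2 * ln (real (n + 1)) \<le> ln (?F n)"
    and upper: "ln (?F n) \<le> G n + 1/2 * ln (real (n + 1))" for n
  proof -
    let ?E = "extremal_norm_bound n (m n)"
    have lo: "?B n / (r ^ m n * ?E) \<le> ?F n" and up: "?F n \<le> ?E / (?A n * r ^ m n)"
      using chebyshev_F_bounds[OF assms, of "m n" n] le by auto
    have lo_pos: "0 < ?B n / (r ^ m n * ?E)"
      using B E assms by simp
    then have "ln (?B n / (r ^ m n * ?E)) \<le> ln (?F n)" "ln (?F n) \<le> ln (?E / (?A n * r ^ m n))"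
      using lo up by simp_all
    moreover have "ln ?E = 1/2 * (ln (real (n + 1)) + ln (?A n) + ln (?B n))"
      using le by (intro ln_extremal_norm_bound) blast
    ultimately show "G n - 1/2 * ln (real (n + 1)) \<le> ln (?F n)"
      "ln (?F n) \<le> G n + 1/2 * ln (real (n + 1))"
      using A[of n] B[of n] E[of n] assms
      by (simp_all add: G_def ln_div ln_mult ln_realpow field_simps del: binomial_Suc_Suc of_nat_add)
  qed
  have limA: "(\<lambda>n. ln (?A n) / real n) \<longlonglongrightarrow> 2 * \<alpha> * ln (2 * \<alpha>) - \<alpha> * ln \<alpha> - (2 * \<alpha> - \<alpha>) * ln (2 * \<alpha> - \<alpha>)"
    using lim tendsto_mult_left[OF lim, of 2] by (intro ln_binomial_asymptotic) auto
  have limB: "(\<lambda>n. ln (?B n) / real n) \<longlonglongrightarrow> (1 + \<alpha>) * ln (1 + \<alpha>) - 2 * \<alpha> * ln (2 * \<alpha>)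
      - (1 + \<alpha> - 2 * \<alpha>) * ln (1 + \<alpha> - 2 * \<alpha>)"
  proof (rule ln_binomial_asymptotic)
    show "2 * m n + 1 \<le> n + m n + 1" for n using le[rule_format, of n] by simp
    have "(\<lambda>n. 2 * (real (m n) / real n) + 1 / real n) \<longlonglongrightarrow> 2 * \<alpha> + 0"
      by (intro tendsto_intros lim lim_1_over_n)
    then show "(\<lambda>n. real (2 * m n + 1) / real n) \<longlonglongrightarrow> 2 * \<alpha>"
      by (simp add: add_divide_distrib add.commute)
    have "(\<lambda>n. 1 + real (m n) / real n + 1 / real n) \<longlonglongrightarrow> 1 + \<alpha> + 0"
      by (intro tendsto_intros lim lim_1_over_n)
    moreover have "\<forall>\<^sub>F n in sequentially. 1 + real (m n) / real n + 1 / real n = real (n + m n + 1) / real n"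
      using eventually_gt_at_top[of 0] by eventually_elim (simp add: field_simps)
    ultimately show "(\<lambda>n. real (n + m n + 1) / real n) \<longlonglongrightarrow> 1 + \<alpha>"
      by (simp add: tendsto_cong)
  qed
  have c_eq: "?c \<alpha> = 1/2 * (((1 + \<alpha>) * ln (1 + \<alpha>) - 2 * \<alpha> * ln (2 * \<alpha>)
        - (1 + \<alpha> - 2 * \<alpha>) * ln (1 + \<alpha> - 2 * \<alpha>)) -
      (2 * \<alpha> * ln (2 * \<alpha>) - \<alpha> * ln \<alpha> - (2 * \<alpha> - \<alpha>) * ln (2 * \<alpha> - \<alpha>))) - \<alpha> * ln r"
  proof -
    have "ln (2 * \<alpha>) = ln 2 + ln \<alpha>" "ln (4 * r) = 2 * ln 2 + ln r"
      using \<alpha> assms ln_realpow[of 2 2] by (simp_all add: ln_mult)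
    then show ?thesis by (simp add: field_simps)
  qed
  have limG: "(\<lambda>n. G n / real n) \<longlonglongrightarrow> ?c \<alpha>"
  proof -
    have "(\<lambda>n. 1/2 * (ln (?B n) / real n - ln (?A n) / real n) - real (m n) / real n * ln r) \<longlonglongrightarrow> ?c \<alpha>"
      unfolding c_eq by (intro tendsto_intros limA limB lim)
    then show ?thesis by (simp add: G_def diff_divide_distrib mult.commute del: binomial_Suc_Suc)
  qed
  have err: "(\<lambda>n. 1/2 * ln (real (n + 1)) / real n) \<longlonglongrightarrow> 0"
  proof (rule Lim_transform_eventually)
    have "(\<lambda>n. 1/2 * (ln (real (Suc n)) / real (Suc n)) * (1 + 1 / real n)) \<longlonglongrightarrow> 1/2 * 0 * (1 + 0)"
      by (intro tendsto_intros LIMSEQ_Suc[OF lim_ln_over_n] lim_1_over_n)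
    then show "(\<lambda>n. 1/2 * (ln (real (Suc n)) / real (Suc n)) * (1 + 1 / real n)) \<longlonglongrightarrow> 0"
      by simp
    show "\<forall>\<^sub>F n in sequentially. 1/2 * (ln (real (Suc n)) / real (Suc n)) * (1 + 1 / real n) =
        1/2 * ln (real (n + 1)) / real n"
      using eventually_gt_at_top[of 0]
    proof eventually_elim
      case (elim n)
      then have "1 + 1 / real n = real (Suc n) / real n" by (simp add: field_simps)
      then show ?case by (simp del: of_nat_Suc)
    qed
  qed
  show "(\<lambda>n. 1 / real n * ln (?F n)) \<longlonglongrightarrow> ?c \<alpha>"
  proof (rule tendsto_sandwich)
    show "(\<lambda>n. G n / real n - 1/2 * ln (real (n + 1)) / real n) \<longlonglongrightarrow> ?c \<alpha>"
      using tendsto_diff[OF limG err] by simp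
    show "(\<lambda>n. G n / real n + 1/2 * ln (real (n + 1)) / real n) \<longlonglongrightarrow> ?c \<alpha>"
      using tendsto_add[OF limG err] by simp
    show "\<forall>\<^sub>F n in sequentially. G n / real n - 1/2 * ln (real (n + 1)) / real n \<le> 1 / real n * ln (?F n)"
    proof (rule always_eventually, rule allI)
      fix n
      show "G n / real n - 1/2 * ln (real (n + 1)) / real n \<le> 1 / real n * ln (?F n)"
        using divide_right_mono[OF lower[of n], of "real n"] by (simp add: diff_divide_distrib)
    qed
    show "\<forall>\<^sub>F n in sequentially. 1 / real n * ln (?F n) \<le> G n / real n + 1/2 * ln (real (n + 1)) / real n"
    proof (rule always_eventually, rule allI)
      fix n
      show "1 / real n * ln (?F n) \<le> G n / real n + 1/2 * ln (real (n + 1)) / real n"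
        using divide_right_mono[OF upper[of n], of "real n"] by (simp add: add_divide_distrib)
    qed
  qed
qed

end
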